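(* If an $\mathcal L^X_{\mathsf{PA}}$-sentence $\varphi$ is a theorem of $\mathsf{PA}[X]$, then $\vdash^\alpha_d\varphi$ (i.e. $\vdash^\alpha_d\{\varphi\}$) for some $\alpha\in E$ and $d\in\mathbb N$.
   Context: $\mathcal L_{\mathsf{PA}}$ is the first-order language with constant $0$, unary function $S$, binary functions $+,\times$ and binary relations $\leq,=$; $\mathcal L^X_{\mathsf{PA}}$ adds a unary relation symbol $X$. Formulas are in negation normal form: built from literals by $\land,\lor,\forall,\exists$; $\neg\varphi$ is defined via de Morgan's laws; $\varphi\to\psi$ abbreviates $\neg\varphi\lor\psi$. "True" refers to the standard model $\mathbb N$. Rank: literals have rank $0$, $\mathrm{rk}(\varphi_0\land\varphi_1)=\mathrm{rk}(\varphi_0\lor\varphi_1)=\max+1$, $\mathrm{rk}(\forall x\varphi)=\mathrm{rk}(\exists x\varphi)=\mathrm{rk}(\varphi)+1$. $\mathsf{PA}[X]$ is the $\mathcal L^X_{\mathsf{PA}}$-theory with the equality axioms (for the extended language), the axioms of Robinson arithmetic, and all induction axioms $\varphi[x/0]\land\forall x(\varphi\to\varphi[x/Sx])\to\forall x\varphi$ for $\mathcal L^X_{\mathsf{PA}}$-formulas $\varphi$. $(E,\prec)$ is a well order with a map $\alpha\mapsto\alpha+1$ satisfying $\alpha\prec\alpha+1$, and elements $0,\omega\in E$ with $0\prec\omega$ such that $\alpha\prec\omega$ implies $\alpha+1\prec\omega$. $x\lhd y$ is a fixed $\mathcal L_{\mathsf{PA}}$-formula with free variables $x,y$ only, defining a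 well order on $\mathbb N$. A sequent is a finite set of $\mathcal L^X_{\mathsf{PA}}$-sentences; $\Gamma,\varphi$ denotes $\Gamma\cup\{\varphi\}$. By recursion on $\alpha\in E$, $\vdash^\alpha_d\Gamma$ holds exactly if one of: (i) $\Gamma$ contains a true $\mathcal L_{\mathsf{PA}}$-literal, or $Xs$ and $\neg Xt$ with closed terms $s,t$ of equal value; (ii) $\Gamma$ contains $\varphi_0\land\varphi_1$ (resp. $\varphi_0\lor\varphi_1$) and for every (resp. some) $i\in\{0,1\}$: $\vdash^{\alpha(i)}_{d(i)}\Delta_i$ with $\alpha(i)\prec\alpha$, $d(i)\leq d$, $\Delta_i\subseteq\Gamma,\varphi_i$; (iii) $\Gamma$ contains $\forall x\varphi$ (resp. $\exists x\varphi$) and for every (resp. some) closed term $t$: $\vdash^{\alpha(t)}_{d(t)}\Delta_t$ with $\alpha(t)\prec\alpha$, $d(t)\leq d$, $\Delta_t\subseteq\Gamma,\varphi[x/t]$; (iv) $\Gamma$ contains $Xt$ and for every closed term $s$ with $s\lhd t$ (by value): $\vdash^{\alpha(s)}_{d(s)}\Delta_s$ with $\alpha(s)\prec\alpha$, $d(s)\leq d$, $\Delta_s\subseteq\Gamma,Xs$; (v) for some sentence $\varphi$ with $\mathrm{rk}(\varphi)<d$: $\vdash^{\alpha(0)}_{d(0)}\Delta_0$ and $\vdash^{\alpha(1)}_{d(1)}\Delta_1$ with $\alpha(i)\prec\alpha$, $d(i)\leq d$, $\Delta_0\subseteq\Gamma,\varphi$, $\Delta_1\subseteq\Gamma,\neg\varphi$.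 *)

theory Defs
  imports Main
begin

text \<open>Terms and formulas use de Bruijn indices: \<open>Var n\<close> refers to the \<open>n\<close>-th
  enclosing quantifier, or to a free variable if there are fewer quantifiers.\<close>

datatype tm = Var nat | Zero | Succ tm | Plus tm tm | Times tm tm

datatype atom = Eq tm tm | Leq tm tm | X tm

datatype fm =
    Pos atom
  | Neg atom
  | And fm fm
  | Or fm fm
  | All fm
  | Ex fm

primrec neg :: "fm \<Rightarrow> fm" where
  "neg (Pos a) = Neg a"
| "neg (Neg a) = Pos a"
| "neg (And p q) = Or (neg p) (neg q)"
| "neg (Or p q) = And (neg p) (neg q)"
| "neg (All p) = Ex (neg p)"
| "neg (Ex p) = All (neg p)"

definition Imp :: "fm \<Rightarrow> fm \<Rightarrow> fm" where
  "Imp p q = Or (neg p) q"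

definition Iff :: "fm \<Rightarrow> fm \<Rightarrow> fm" where
  "Iff p q = And (Imp p q) (Imp q p)"

primrec rk :: "fm \<Rightarrow> nat" where
  "rk (Pos a) = 0"
| "rk (Neg a) = 0"
| "rk (And p q) = max (rk p) (rk q) + 1"
| "rk (Or p q) = max (rk p) (rk q) + 1"
| "rk (All p) = rk p + 1"
| "rk (Ex p) = rk p + 1"

primrec fv_tm :: "tm \<Rightarrow> nat set" where
  "fv_tm (Var n) = {n}"
| "fv_tm Zero = {}"
| "fv_tm (Succ t) = fv_tm t"
| "fv_tm (Plus s t) = fv_tm s \<union> fv_tm t"
| "fv_tm (Times s t) = fv_tm s \<union> fv_tm t"

primrec fv_atom :: "atom \<Rightarrow> nat set" where
  "fv_atom (Eq s t) = fv_tm s \<union> fv_tm t"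
| "fv_atom (Leq s t) = fv_tm s \<union> fv_tm t"
| "fv_atom (X t) = fv_tm t"

primrec fv :: "fm \<Rightarrow> nat set" where
  "fv (Pos a) = fv_atom a"
| "fv (Neg a) = fv_atom a"
| "fv (And p q) = fv p \<union> fv q"
| "fv (Or p q) = fv p \<union> fv q"
| "fv (All p) = {n. Suc n \<in> fv p}"
| "fv (Ex p) = {n. Suc n \<in> fv p}"

definition closed_tm :: "tm \<Rightarrow> bool" where
  "closed_tm t \<longleftrightarrow> fv_tm t = {}"

definition sentence :: "fm \<Rightarrow> bool" where
  "sentence p \<longleftrightarrow> fv p = {}"

text \<open>Simultaneous, capture-avoiding substitution.\<close>

primrec subst_tm :: "(nat \<Rightarrow> tm) \<Rightarrow> tm \<Rightarrow> tm" where
  "subst_tm \<sigma> (Var n) = \<sigma> n"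
| "subst_tm \<sigma> Zero = Zero"
| "subst_tm \<sigma> (Succ t) = Succ (subst_tm \<sigma> t)"
| "subst_tm \<sigma> (Plus s t) = Plus (subst_tm \<sigma> s) (subst_tm \<sigma> t)"
| "subst_tm \<sigma> (Times s t) = Times (subst_tm \<sigma> s) (subst_tm \<sigma> t)"

primrec subst_atom :: "(nat \<Rightarrow> tm) \<Rightarrow> atom \<Rightarrow> atom" where
  "subst_atom \<sigma> (Eq s t) = Eq (subst_tm \<sigma> s) (subst_tm \<sigma> t)"
| "subst_atom \<sigma> (Leq s t) = Leq (subst_tm \<sigma> s) (subst_tm \<sigma> t)"
| "subst_atom \<sigma> (X t) = X (subst_tm \<sigma> t)"

definition up :: "(nat \<Rightarrow> tm) \<Rightarrow> nat \<Rightarrow> tm" where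
  "up \<sigma> = case_nat (Var 0) (\<lambda>n. subst_tm (\<lambda>k. Var (Suc k)) (\<sigma> n))"

primrec subst :: "(nat \<Rightarrow> tm) \<Rightarrow> fm \<Rightarrow> fm" where
  "subst \<sigma> (Pos a) = Pos (subst_atom \<sigma> a)"
| "subst \<sigma> (Neg a) = Neg (subst_atom \<sigma> a)"
| "subst \<sigma> (And p q) = And (subst \<sigma> p) (subst \<sigma> q)"
| "subst \<sigma> (Or p q) = Or (subst \<sigma> p) (subst \<sigma> q)"
| "subst \<sigma> (All p) = All (subst (up \<sigma>) p)"
| "subst \<sigma> (Ex p) = Ex (subst (up \<sigma>) p)"

text \<open>If \<open>p\<close> is the body of \<open>All p\<close> or \<open>Ex p\<close> with bound variable \<open>x\<close>, then \<open>inst t p\<close>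
  is \<open>p[x/t]\<close>, with the index of \<open>x\<close> discharged.\<close>

definition inst :: "tm \<Rightarrow> fm \<Rightarrow> fm" where
  "inst t = subst (case_nat t Var)"

definition shift :: "fm \<Rightarrow> fm" where
  "shift = subst (\<lambda>n. Var (Suc n))"

primrec val_tm :: "(nat \<Rightarrow> nat) \<Rightarrow> tm \<Rightarrow> nat" where
  "val_tm e (Var n) = e n"
| "val_tm e Zero = 0"
| "val_tm e (Succ t) = Suc (val_tm e t)"
| "val_tm e (Plus s t) = val_tm e s + val_tm e t"
| "val_tm e (Times s t) = val_tm e s * val_tm e t"

text \<open>The value of a closed term; the environment is irrelevant.\<close>

definition val :: "tm \<Rightarrow> nat" where
  "val t = val_tm (\<lambda>_. 0) t"

primrec X_free_atom :: "atom \<Rightarrow> bool" where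
  "X_free_atom (Eq s t) = True"
| "X_free_atom (Leq s t) = True"
| "X_free_atom (X t) = False"

text \<open>\<open>X_free p\<close> says that \<open>p\<close> is a formula of the language without \<open>X\<close>.\<close>

primrec X_free :: "fm \<Rightarrow> bool" where
  "X_free (Pos a) = X_free_atom a"
| "X_free (Neg a) = X_free_atom a"
| "X_free (And p q) = (X_free p \<and> X_free q)"
| "X_free (Or p q) = (X_free p \<and> X_free q)"
| "X_free (All p) = X_free p"
| "X_free (Ex p) = X_free p"

text \<open>Satisfaction in the standard model, with \<open>X\<close> interpreted by the set \<open>A\<close>.\<close>

primrec sat_atom :: "nat set \<Rightarrow> (nat \<Rightarrow> nat) \<Rightarrow> atom \<Rightarrow> bool" where
  "sat_atom A e (Eq s t) \<longleftrightarrow> val_tm e s = val_tm e t"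
| "sat_atom A e (Leq s t) \<longleftrightarrow> val_tm e s \<le> val_tm e t"
| "sat_atom A e (X t) \<longleftrightarrow> val_tm e t \<in> A"

primrec sat :: "nat set \<Rightarrow> (nat \<Rightarrow> nat) \<Rightarrow> fm \<Rightarrow> bool" where
  "sat A e (Pos a) \<longleftrightarrow> sat_atom A e a"
| "sat A e (Neg a) \<longleftrightarrow> \<not> sat_atom A e a"
| "sat A e (And p q) \<longleftrightarrow> sat A e p \<and> sat A e q"
| "sat A e (Or p q) \<longleftrightarrow> sat A e p \<or> sat A e q"
| "sat A e (All p) \<longleftrightarrow> (\<forall>n. sat A (case_nat n e) p)"
| "sat A e (Ex p) \<longleftrightarrow> (\<exists>n. sat A (case_nat n e) p)"

text \<open>Truth of a sentence without \<open>X\<close>; neither the interpretation of \<open>X\<close> nor the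
  environment matters, and both are chosen arbitrarily.\<close>

definition true_PA :: "fm \<Rightarrow> bool" where
  "true_PA p \<longleftrightarrow> sentence p \<and> X_free p \<and> sat {} (\<lambda>_. 0) p"

definition literal :: "fm \<Rightarrow> bool" where
  "literal p \<longleftrightarrow> (\<exists>a. p = Pos a \<or> p = Neg a)"

text \<open>Pure first-order logic as a one-sided sequent calculus for negation normal forms,
  with cut; a sequent is read as the disjunction of its members and may contain free
  variables. Equality is handled by axioms of the theory. In rule \<open>All\<close> the eigenvariable
  is index 0, which is fresh for the shifted context.\<close>

inductive LK :: "fm set \<Rightarrow> bool" where
  Ax: "finite \<Gamma> \<Longrightarrow> Pos a \<in> \<Gamma> \<Longrightarrow> Neg a \<in> \<Gamma> \<Longrightarrow> LK \<Gamma>"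
| And: "LK (insert p \<Gamma>) \<Longrightarrow> LK (insert q \<Gamma>) \<Longrightarrow> LK (insert (And p q) \<Gamma>)"
| Or1: "LK (insert p \<Gamma>) \<Longrightarrow> LK (insert (Or p q) \<Gamma>)"
| Or2: "LK (insert q \<Gamma>) \<Longrightarrow> LK (insert (Or p q) \<Gamma>)"
| All: "LK (insert p (shift ` \<Gamma>)) \<Longrightarrow> LK (insert (All p) \<Gamma>)"
| Ex: "LK (insert (inst t p) \<Gamma>) \<Longrightarrow> LK (insert (Ex p) \<Gamma>)"
| Cut: "LK (insert p \<Gamma>) \<Longrightarrow> LK (insert (neg p) \<Gamma>) \<Longrightarrow> LK \<Gamma>"

text \<open>Provability of \<open>p\<close> from a set \<open>T\<close> of sentences.\<close>

definition provable :: "fm set \<Rightarrow> fm \<Rightarrow> bool" where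
  "provable T p \<longleftrightarrow> (\<exists>\<Delta>. finite \<Delta> \<and> \<Delta> \<subseteq> T \<and> LK (insert p (neg ` \<Delta>)))"

definition equality_axioms :: "fm set" where
  "equality_axioms =
    {All (Pos (Eq (Var 0) (Var 0))),
     All (All (Imp (Pos (Eq (Var 1) (Var 0))) (Pos (Eq (Var 0) (Var 1))))),
     All (All (All (Imp (And (Pos (Eq (Var 2) (Var 1))) (Pos (Eq (Var 1) (Var 0))))
       (Pos (Eq (Var 2) (Var 0)))))),
     All (All (Imp (Pos (Eq (Var 1) (Var 0))) (Pos (Eq (Succ (Var 1)) (Succ (Var 0)))))),
     All (All (All (All (Imp (And (Pos (Eq (Var 3) (Var 2))) (Pos (Eq (Var 1) (Var 0))))
       (Pos (Eq (Plus (Var 3) (Var 1)) (Plus (Var 2) (Var 0)))))))),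
     All (All (All (All (Imp (And (Pos (Eq (Var 3) (Var 2))) (Pos (Eq (Var 1) (Var 0))))
       (Pos (Eq (Times (Var 3) (Var 1)) (Times (Var 2) (Var 0)))))))),
     All (All (All (All (Imp (And (Pos (Eq (Var 3) (Var 2))) (Pos (Eq (Var 1) (Var 0))))
       (Imp (Pos (Leq (Var 3) (Var 1))) (Pos (Leq (Var 2) (Var 0)))))))),
     All (All (Imp (Pos (Eq (Var 1) (Var 0))) (Imp (Pos (X (Var 1))) (Pos (X (Var 0))))))}"

definition robinson_axioms :: "fm set" where
  "robinson_axioms =
    {All (Neg (Eq (Succ (Var 0)) Zero)),
     All (All (Imp (Pos (Eq (Succ (Var 1)) (Succ (Var 0)))) (Pos (Eq (Var 1) (Var 0))))),
     All (Imp (Neg (Eq (Var 0) Zero)) (Ex (Pos (Eq (Var 1) (Succ (Var 0)))))),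
     All (Pos (Eq (Plus (Var 0) Zero) (Var 0))),
     All (All (Pos (Eq (Plus (Var 1) (Succ (Var 0))) (Succ (Plus (Var 1) (Var 0)))))),
     All (Pos (Eq (Times (Var 0) Zero) Zero)),
     All (All (Pos (Eq (Times (Var 1) (Succ (Var 0))) (Plus (Times (Var 1) (Var 0)) (Var 1))))),
     All (All (Iff (Pos (Leq (Var 1) (Var 0)))
       (Ex (Pos (Eq (Plus (Var 0) (Var 2)) (Var 1))))))}"

text \<open>The induction formula for \<open>p\<close> with respect to the variable of index 0. In the
  induction step, \<open>p[x/Sx]\<close> is formed under the quantifier for \<open>x\<close>, so the other indices
  stay fixed.\<close>

definition induction_fm :: "fm \<Rightarrow> fm" where
  "induction_fm p =
    Imp (And (inst Zero p)
             (All (Imp p (subst (case_nat (Succ (Var 0)) (\<lambda>n. Var (Suc n))) p))))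
        (All p)"

text \<open>Parameters are universally quantified; prefixes with vacuous quantifiers are also
  admitted.\<close>

definition induction_axioms :: "fm set" where
  "induction_axioms =
    {(All ^^ n) (induction_fm p) | n p. sentence ((All ^^ n) (induction_fm p))}"

definition PAX :: "fm set" where
  "PAX = equality_axioms \<union> robinson_axioms \<union> induction_axioms"

text \<open>The relation on the natural numbers defined by a formula \<open>\<theta>\<close> without \<open>X\<close>, whose free
  variables \<open>x\<close> and \<open>y\<close> are represented by the indices 0 and 1.\<close>

definition defined_rel :: "fm \<Rightarrow> (nat \<times> nat) set" where
  "defined_rel \<theta> = {(m, n). sat {} (case_nat m (\<lambda>_. n)) \<theta>}"

definition defines_strict_well_order :: "fm \<Rightarrow> bool" where
  "defines_strict_well_order \<theta> \<longleftrightarrow>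
     X_free \<theta> \<and> fv \<theta> \<subseteq> {0, 1} \<and>
     strict_linear_order (defined_rel \<theta>) \<and> wf (defined_rel \<theta>)"

definition sequent :: "fm set \<Rightarrow> bool" where
  "sequent \<Gamma> \<longleftrightarrow> finite \<Gamma> \<and> (\<forall>p\<in>\<Gamma>. sentence p)"

text \<open>\<open>deriv \<theta> \<alpha> d \<Gamma>\<close> is derivability of \<open>\<Gamma>\<close> with height \<open>\<alpha>\<close> and cut rank \<open>d\<close> in the
  infinitary calculus for the order defined by \<open>\<theta>\<close>. All premises have smaller height in a
  well order, so this least fixed point is the only relation satisfying the clauses,
  i.e. the one given by recursion on \<open>\<alpha>\<close>.\<close>

inductive deriv :: "fm \<Rightarrow> 'e::wellorder \<Rightarrow> nat \<Rightarrow> fm set \<Rightarrow> bool" for \<theta> :: fm where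
  ax_true:
    "sequent \<Gamma> \<Longrightarrow> p \<in> \<Gamma> \<Longrightarrow> literal p \<Longrightarrow> true_PA p \<Longrightarrow> deriv \<theta> \<alpha> d \<Gamma>"
| ax_X:
    "sequent \<Gamma> \<Longrightarrow> Pos (X s) \<in> \<Gamma> \<Longrightarrow> Neg (X t) \<in> \<Gamma> \<Longrightarrow> val s = val t \<Longrightarrow> deriv \<theta> \<alpha> d \<Gamma>"
| conj:
    "sequent \<Gamma> \<Longrightarrow> And p q \<in> \<Gamma> \<Longrightarrow>
     \<forall>r\<in>{p, q}. \<exists>\<beta><\<alpha>. \<exists>e\<le>d. \<exists>\<Delta>\<subseteq>insert r \<Gamma>. deriv \<theta> \<beta> e \<Delta> \<Longrightarrow> deriv \<theta> \<alpha> d \<Gamma>"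
| disj:
    "sequent \<Gamma> \<Longrightarrow> Or p q \<in> \<Gamma> \<Longrightarrow>
     \<exists>r\<in>{p, q}. \<exists>\<beta><\<alpha>. \<exists>e\<le>d. \<exists>\<Delta>\<subseteq>insert r \<Gamma>. deriv \<theta> \<beta> e \<Delta> \<Longrightarrow> deriv \<theta> \<alpha> d \<Gamma>"
| univ:
    "sequent \<Gamma> \<Longrightarrow> All p \<in> \<Gamma> \<Longrightarrow>
     \<forall>t. closed_tm t \<longrightarrow>
       (\<exists>\<beta><\<alpha>. \<exists>e\<le>d. \<exists>\<Delta>\<subseteq>insert (inst t p) \<Gamma>. deriv \<theta> \<beta> e \<Delta>) \<Longrightarrow> deriv \<theta> \<alpha> d \<Gamma>"
| exis:
    "sequent \<Gamma> \<Longrightarrow> Ex p \<in> \<Gamma> \<Longrightarrow>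
     \<exists>t. closed_tm t \<and>
       (\<exists>\<beta><\<alpha>. \<exists>e\<le>d. \<exists>\<Delta>\<subseteq>insert (inst t p) \<Gamma>. deriv \<theta> \<beta> e \<Delta>) \<Longrightarrow> deriv \<theta> \<alpha> d \<Gamma>"
| prog:
    "sequent \<Gamma> \<Longrightarrow> Pos (X t) \<in> \<Gamma> \<Longrightarrow>
     \<forall>s. closed_tm s \<and> (val s, val t) \<in> defined_rel \<theta> \<longrightarrow>
       (\<exists>\<beta><\<alpha>. \<exists>e\<le>d. \<exists>\<Delta>\<subseteq>insert (Pos (X s)) \<Gamma>. deriv \<theta> \<beta> e \<Delta>) \<Longrightarrow> deriv \<theta> \<alpha> d \<Gamma>"
| cut:
    "sequent \<Gamma> \<Longrightarrow> sentence p \<Longrightarrow> rk p < d \<Longrightarrow>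
     \<forall>r\<in>{p, neg p}. \<exists>\<beta><\<alpha>. \<exists>e\<le>d. \<exists>\<Delta>\<subseteq>insert r \<Gamma>. deriv \<theta> \<beta> e \<Delta> \<Longrightarrow> deriv \<theta> \<alpha> d \<Gamma>"

end

theory Submission
  imports Defs
begin

text \<open>Finite proofs of \<open>PA[X]\<close> are embedded into the infinitary calculus: every sequent of a
  proof in first-order logic is derivable, under all closed substitutions simultaneously, with a
  height that is finitely many successors above \<open>\<omega>\<close>. Axioms without \<open>X\<close> are true and thus have
  derivations of finite height. Induction for \<open>\<phi>\<close> is replaced by the \<open>\<omega>\<close>-rule: a derivation of
  \<open>\<phi>(t)\<close> from \<open>\<phi>(0)\<close> and \<open>\<forall>x. \<phi>(x) \<longrightarrow> \<phi>(Sx)\<close> is built by recursion on the value of \<open>t\<close>, so that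
  all heights are finite and the universal quantifier is introduced at height \<open>\<omega>\<close>. Finally all
  axioms that were used are removed by cuts.\<close>

section \<open>Substitution\<close>

lemma subst_tm_cong: "(\<And>n. n \<in> fv_tm t \<Longrightarrow> \<sigma> n = \<tau> n) \<Longrightarrow> subst_tm \<sigma> t = subst_tm \<tau> t"
  by (induction t) auto

lemma subst_tm_Var [simp]: "subst_tm Var t = t"
  by (induction t) auto

lemma subst_tm_subst_tm: "subst_tm \<sigma> (subst_tm \<tau> t) = subst_tm (\<lambda>n. subst_tm \<sigma> (\<tau> n)) t"
  by (induction t) auto

lemma subst_atom_cong: "(\<And>n. n \<in> fv_atom a \<Longrightarrow> \<sigma> n = \<tau> n) \<Longrightarrow> subst_atom \<sigma> a = subst_atom \<tau> a"
  by (cases a) (auto intro: subst_tm_cong)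

lemma subst_atom_Var [simp]: "subst_atom Var a = a"
  by (cases a) auto

lemma subst_atom_subst_atom:
  "subst_atom \<sigma> (subst_atom \<tau> a) = subst_atom (\<lambda>n. subst_tm \<sigma> (\<tau> n)) a"
  by (cases a) (auto simp: subst_tm_subst_tm)

lemma up_Var [simp]: "up Var = Var"
  by (rule ext) (simp add: up_def split: nat.split)

text \<open>Index 0 is fixed by both lifts, and a shifted term does not contain it, so
  \<open>up \<sigma>\<close> acts there as \<open>\<sigma>\<close> followed by a shift. This carries
  \<open>subst_subst\<close> under the quantifiers.\<close>

lemma up_comp: "(\<lambda>n. subst_tm (up \<sigma>) (up \<tau> n)) = up (\<lambda>n. subst_tm \<sigma> (\<tau> n))"
  by (rule ext) (simp add: up_def subst_tm_subst_tm split: nat.split)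

lemma subst_cong: "(\<And>n. n \<in> fv p \<Longrightarrow> \<sigma> n = \<tau> n) \<Longrightarrow> subst \<sigma> p = subst \<tau> p"
proof (induction p arbitrary: \<sigma> \<tau>)
  case (All p)
  have "subst (up \<sigma>) p = subst (up \<tau>) p"
  proof (rule All.IH)
    show "up \<sigma> n = up \<tau> n" if "n \<in> fv p" for n
      using that All.prems by (cases n) (auto simp: up_def)
  qed
  then show ?case by simp
next
  case (Ex p)
  have "subst (up \<sigma>) p = subst (up \<tau>) p"
  proof (rule Ex.IH)
    show "up \<sigma> n = up \<tau> n" if "n \<in> fv p" for n
      using that Ex.prems by (cases n) (auto simp: up_def)
  qed
  then show ?case by simp
next
  case (And p q)
  have "subst \<sigma> p = subst \<tau> p" "subst \<sigma> q = subst \<tau> q"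
    using And.prems by (auto intro!: And.IH)
  then show ?case by simp
next
  case (Or p q)
  have "subst \<sigma> p = subst \<tau> p" "subst \<sigma> q = subst \<tau> q"
    using Or.prems by (auto intro!: Or.IH)
  then show ?case by simp
qed (auto intro: subst_atom_cong)

lemma subst_Var [simp]: "subst Var p = p"
  by (induction p) auto

lemma subst_subst: "subst \<sigma> (subst \<tau> p) = subst (\<lambda>n. subst_tm \<sigma> (\<tau> n)) p"
  by (induction p arbitrary: \<sigma> \<tau>) (auto simp: subst_atom_subst_atom up_comp)

lemma subst_sentence: "sentence p \<Longrightarrow> subst \<sigma> p = p"
  using subst_cong[of p \<sigma> Var] by (simp add: sentence_def)

text \<open>The instantiation undoes the shift made by \<open>up\<close>. Premises of the quantifier
  rules thereby become \<open>p\<close> under an extended substitution, to which an induction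
  hypothesis for all substitutions applies.\<close>

lemma inst_subst_up: "inst t (subst (up \<sigma>) p) = subst (case_nat t \<sigma>) p"
  unfolding inst_def subst_subst
  by (rule subst_cong) (simp add: up_def subst_tm_subst_tm split: nat.split)

lemma subst_inst: "subst \<sigma> (inst t p) = subst (case_nat (subst_tm \<sigma> t) \<sigma>) p"
  unfolding inst_def subst_subst
  by (rule subst_cong) (simp split: nat.split)

text \<open>Captures freshness of the eigenvariable: a shifted formula does not mention index 0, so
  the term put there has no effect.\<close>

lemma subst_case_nat_shift: "subst (case_nat t \<sigma>) (shift p) = subst \<sigma> p"
  unfolding shift_def subst_subst by simp

section \<open>Negation, rank and free variables under substitution\<close>

lemma neg_neg [simp]: "neg (neg p) = p"
  by (induction p) auto

lemma rk_neg [simp]: "rk (neg p) = rk p"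
  by (induction p) auto

lemma fv_neg [simp]: "fv (neg p) = fv p"
  by (induction p) auto

lemma sentence_neg [simp]: "sentence (neg p) = sentence p"
  by (simp add: sentence_def)

lemma subst_neg: "subst \<sigma> (neg p) = neg (subst \<sigma> p)"
  by (induction p arbitrary: \<sigma>) auto

lemma rk_subst [simp]: "rk (subst \<sigma> p) = rk p"
  by (induction p arbitrary: \<sigma>) auto

lemma X_free_atom_subst [simp]: "X_free_atom (subst_atom \<sigma> a) = X_free_atom a"
  by (cases a) auto

lemma fv_subst_tm: "fv_tm (subst_tm \<sigma> t) = (\<Union>n\<in>fv_tm t. fv_tm (\<sigma> n))"
  by (induction t) auto

lemma fv_subst_atom: "fv_atom (subst_atom \<sigma> a) = (\<Union>n\<in>fv_atom a. fv_tm (\<sigma> n))"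
  by (cases a) (auto simp: fv_subst_tm)

lemma Suc_in_fv_up: "Suc m \<in> fv_tm (up \<sigma> n) \<longleftrightarrow> (\<exists>k. n = Suc k \<and> m \<in> fv_tm (\<sigma> k))"
  by (cases n) (auto simp: up_def fv_subst_tm)

lemma fv_subst: "fv (subst \<sigma> p) = (\<Union>n\<in>fv p. fv_tm (\<sigma> n))"
  by (induction p arbitrary: \<sigma>) (auto simp: fv_subst_atom Suc_in_fv_up)

text \<open>Closedness is demanded at every index, so that any formula becomes a sentence without
  tracking its free variables.\<close>

definition closed_subst :: "(nat \<Rightarrow> tm) \<Rightarrow> bool" where
  "closed_subst \<sigma> \<longleftrightarrow> (\<forall>n. closed_tm (\<sigma> n))"

lemma closed_subst_case_nat:
  "closed_tm t \<Longrightarrow> closed_subst \<sigma> \<Longrightarrow> closed_subst (case_nat t \<sigma>)"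
  by (auto simp: closed_subst_def split: nat.split)

lemma closed_tm_subst: "closed_subst \<sigma> \<Longrightarrow> closed_tm (subst_tm \<sigma> t)"
  by (auto simp: closed_subst_def closed_tm_def fv_subst_tm)

lemma sentence_subst: "closed_subst \<sigma> \<Longrightarrow> sentence (subst \<sigma> p)"
  by (auto simp: closed_subst_def closed_tm_def sentence_def fv_subst)

section \<open>Values, satisfaction and numerals\<close>

lemma val_tm_subst: "val_tm e (subst_tm \<sigma> t) = val_tm (\<lambda>n. val_tm e (\<sigma> n)) t"
  by (induction t) auto

lemma sat_atom_subst: "sat_atom A e (subst_atom \<sigma> a) = sat_atom A (\<lambda>n. val_tm e (\<sigma> n)) a"
  by (cases a) (auto simp: val_tm_subst)

lemma val_subst: "val (subst_tm \<sigma> t) = val_tm (\<lambda>n. val (\<sigma> n)) t"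
  by (simp add: val_def val_tm_subst)

text \<open>Canonical closed terms of prescribed value, used as witnesses for true existential
  formulas and as predecessors in the induction argument.\<close>

primrec numeral_tm :: "nat \<Rightarrow> tm" where
  "numeral_tm 0 = Zero"
| "numeral_tm (Suc n) = Succ (numeral_tm n)"

lemma closed_numeral_tm [simp]: "closed_tm (numeral_tm n)"
  by (induction n) (auto simp: closed_tm_def)

lemma val_numeral_tm [simp]: "val (numeral_tm n) = n"
  by (induction n) (auto simp: val_def)

lemma val_Succ [simp]: "val (Succ t) = Suc (val t)" and val_Zero [simp]: "val Zero = 0"
  by (simp_all add: val_def)

lemma closed_Succ [simp]: "closed_tm (Succ t) = closed_tm t"
  and closed_Zero [simp]: "closed_tm Zero"
  by (simp_all add: closed_tm_def)

section \<open>Derived rules of the infinitary calculus\<close>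

lemma deriv_sequent: "deriv \<theta> \<alpha> d \<Gamma> \<Longrightarrow> sequent \<Gamma>"
  by (induction rule: deriv.induct) auto

lemma sequent_insert [simp]: "sequent (insert p \<Gamma>) \<longleftrightarrow> sentence p \<and> sequent \<Gamma>"
  by (auto simp: sequent_def)

lemma sequent_empty [simp]: "sequent {}"
  by (simp add: sequent_def)

text \<open>The rules only bound the height, cut rank and context of their premises. The premises of
  the last rule therefore remain admissible as they stand, and a case distinction on that rule
  suffices.\<close>

lemma deriv_weaken:
  fixes \<alpha> \<beta> :: "'e::wellorder"
  assumes "deriv \<theta> \<alpha> d \<Gamma>" "\<alpha> \<le> \<beta>" "d \<le> e" "\<Gamma> \<subseteq> \<Delta>" "sequent \<Delta>"
  shows "deriv \<theta> \<beta> e \<Delta>"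
proof -
  have premise: "\<exists>\<gamma><\<beta>. \<exists>c\<le>e. \<exists>\<Lambda>\<subseteq>insert r \<Delta>. deriv \<theta> \<gamma> c \<Lambda>"
    if "\<exists>\<gamma><\<alpha>. \<exists>c\<le>d. \<exists>\<Lambda>\<subseteq>insert r \<Gamma>. deriv \<theta> \<gamma> c \<Lambda>" for r
  proof -
    from that obtain \<gamma> c \<Lambda> where *: "\<gamma> < \<alpha>" "c \<le> d" "\<Lambda> \<subseteq> insert r \<Gamma>" "deriv \<theta> \<gamma> c \<Lambda>"
      by blast
    then have "\<gamma> < \<beta>" "c \<le> e" "\<Lambda> \<subseteq> insert r \<Delta>"
      using assms(2-4) by auto
    with *(4) show ?thesis by blast
  qed
  from assms(1) show ?thesis
  proof cases
    case (ax_true p)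
    then show ?thesis using assms(4,5) by (blast intro: deriv.ax_true)
  next
    case (ax_X s t)
    then show ?thesis using assms(4,5) by (blast intro: deriv.ax_X)
  next
    case (conj p q)
    from subsetD[OF assms(4) conj(2)] show ?thesis
      by (rule deriv.conj[OF assms(5)]) (intro ballI premise, erule bspec[OF conj(3)])
  next
    case (disj p q)
    from disj(3) obtain r where "r \<in> {p, q}"
      "\<exists>\<gamma><\<alpha>. \<exists>c\<le>d. \<exists>\<Lambda>\<subseteq>insert r \<Gamma>. deriv \<theta> \<gamma> c \<Lambda>"
      by (rule bexE)
    with subsetD[OF assms(4) disj(2)] show ?thesis
      by (intro deriv.disj[OF assms(5), of p q] bexI[of _ r] premise)
  next
    case (univ p)
    from subsetD[OF assms(4) univ(2)] show ?thesis
      by (rule deriv.univ[OF assms(5)]) (intro allI impI premise univ(3)[rule_format])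
  next
    case (exis p)
    from exis(3) obtain t where "closed_tm t"
      "\<exists>\<gamma><\<alpha>. \<exists>c\<le>d. \<exists>\<Lambda>\<subseteq>insert (inst t p) \<Gamma>. deriv \<theta> \<gamma> c \<Lambda>"
      by blast
    with subsetD[OF assms(4) exis(2)] show ?thesis
      by (intro deriv.exis[OF assms(5), of p] exI[of _ t] conjI premise)
  next
    case (prog t)
    from subsetD[OF assms(4) prog(2)] show ?thesis
      by (rule deriv.prog[OF assms(5)]) (intro allI impI premise prog(3)[rule_format])
  next
    case (cut p)
    from cut(2) less_le_trans[OF cut(3) assms(3)] show ?thesis
      by (rule deriv.cut[OF assms(5)]) (intro ballI premise, erule bspec[OF cut(4)])
  qed
qed

text \<open>First of the working forms of the rules: all premises have cut rank \<open>d\<close>,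
  and the principal formula stays in the context.\<close>

lemma deriv_And:
  assumes "deriv \<theta> \<beta> d (insert p \<Gamma>)" "deriv \<theta> \<beta> d (insert q \<Gamma>)" "And p q \<in> \<Gamma>" "\<beta> < \<alpha>"
  shows "deriv \<theta> \<alpha> d \<Gamma>"
proof (rule deriv.conj)
  show "sequent \<Gamma>" using deriv_sequent[OF assms(1)] by simp
  show "\<forall>r\<in>{p, q}. \<exists>\<beta><\<alpha>. \<exists>e\<le>d. \<exists>\<Delta>\<subseteq>insert r \<Gamma>. deriv \<theta> \<beta> e \<Delta>"
    using assms by blast
qed fact

lemma deriv_Or:
  assumes "deriv \<theta> \<beta> d (insert r \<Gamma>)" "Or p q \<in> \<Gamma>" "r = p \<or> r = q" "\<beta> < \<alpha>"
  shows "deriv \<theta> \<alpha> d \<Gamma>"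
proof (rule deriv.disj)
  show "sequent \<Gamma>" using deriv_sequent[OF assms(1)] by simp
  show "\<exists>r\<in>{p, q}. \<exists>\<beta><\<alpha>. \<exists>e\<le>d. \<exists>\<Delta>\<subseteq>insert r \<Gamma>. deriv \<theta> \<beta> e \<Delta>"
    using assms by blast
qed fact

text \<open>The premise height may vary with \<open>t\<close>. This serves the induction axioms,
  where heights grow with the value of \<open>t\<close>.\<close>

lemma deriv_All:
  assumes "\<And>t. closed_tm t \<Longrightarrow> \<exists>\<beta><\<alpha>. deriv \<theta> \<beta> d (insert (inst t p) \<Gamma>)" "All p \<in> \<Gamma>"
  shows "deriv \<theta> \<alpha> d \<Gamma>"
proof (rule deriv.univ)
  \<comment> \<open>Some closed term has to be supplied to read off from a premise that
    \<open>\<Gamma>\<close> is a sequent.\<close>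
  show "sequent \<Gamma>"
    using assms(1)[of Zero] deriv_sequent by fastforce
  show "\<forall>t. closed_tm t \<longrightarrow>
      (\<exists>\<beta><\<alpha>. \<exists>e\<le>d. \<exists>\<Delta>\<subseteq>insert (inst t p) \<Gamma>. deriv \<theta> \<beta> e \<Delta>)"
    using assms(1) by blast
qed fact

lemma deriv_Ex:
  assumes "deriv \<theta> \<beta> d (insert (inst t p) \<Gamma>)" "Ex p \<in> \<Gamma>" "closed_tm t" "\<beta> < \<alpha>"
  shows "deriv \<theta> \<alpha> d \<Gamma>"
proof (rule deriv.exis)
  show "sequent \<Gamma>" using deriv_sequent[OF assms(1)] by simp
  show "\<exists>t. closed_tm t \<and>
      (\<exists>\<beta><\<alpha>. \<exists>e\<le>d. \<exists>\<Delta>\<subseteq>insert (inst t p) \<Gamma>. deriv \<theta> \<beta> e \<Delta>)"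
    using assms by blast
qed fact

lemma deriv_Cut:
  assumes "deriv \<theta> \<beta> d (insert p \<Gamma>)" "deriv \<theta> \<beta> d (insert (neg p) \<Gamma>)" "rk p < d" "\<beta> < \<alpha>"
  shows "deriv \<theta> \<alpha> d \<Gamma>"
proof (rule deriv.cut)
  show "sequent \<Gamma>" "sentence p" using deriv_sequent[OF assms(1)] by simp_all
  show "\<forall>r\<in>{p, neg p}. \<exists>\<beta><\<alpha>. \<exists>e\<le>d. \<exists>\<Delta>\<subseteq>insert r \<Gamma>. deriv \<theta> \<beta> e \<Delta>"
    using assms by blast
qed fact

text \<open>Each quantifier of the prefix costs one level. The hypothesis is uniform in the closed
  substitution because stripping a quantifier replaces \<open>\<sigma>\<close> by
  \<open>case_nat t \<sigma>\<close>.\<close>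

lemma deriv_All_closure:
  fixes g :: "nat \<Rightarrow> 'e::wellorder"
  assumes "strict_mono g" "closed_subst \<sigma>"
    and "\<And>\<sigma>. closed_subst \<sigma> \<Longrightarrow> deriv \<theta> (g m) d {subst \<sigma> p}"
  shows "deriv \<theta> (g (m + n)) d {subst \<sigma> ((All ^^ n) p)}"
  using assms(2)
proof (induction n arbitrary: \<sigma>)
  case 0
  then show ?case using assms(3) by simp
next
  case (Suc n)
  let ?P = "All (subst (up \<sigma>) ((All ^^ n) p))"
  have "deriv \<theta> (g (m + Suc n)) d {?P}"
  proof (rule deriv_All)
    fix t assume t: "closed_tm t"
    have "deriv \<theta> (g (m + n)) d {inst t (subst (up \<sigma>) ((All ^^ n) p))}"
      using Suc.IH[OF closed_subst_case_nat[OF t Suc.prems]] by (simp add: inst_subst_up)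
    then have "deriv \<theta> (g (m + n)) d {inst t (subst (up \<sigma>) ((All ^^ n) p)), ?P}"
      by (rule deriv_weaken)
        (use sentence_subst[OF Suc.prems, of "All ((All ^^ n) p)"]
           sentence_subst[OF closed_subst_case_nat[OF t Suc.prems]]
          in \<open>auto simp: inst_subst_up\<close>)
    moreover have "g (m + n) < g (m + Suc n)"
      using assms(1) by (simp add: strict_mono_less)
    ultimately show "\<exists>\<beta><g (m + Suc n).
        deriv \<theta> \<beta> d (insert (inst t (subst (up \<sigma>) ((All ^^ n) p))) {?P})"
      by blast
  qed simp
  then show ?case by simp
qed

section \<open>Tautologies and true sentences\<close>

lemma deriv_true_literal:
  assumes "literal p" "true_PA p" "p \<in> \<Gamma>" "sequent \<Gamma>"
  shows "deriv \<theta> \<alpha> d \<Gamma>"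
  using assms by (intro deriv.ax_true)

text \<open>The derivation follows the truth definition, with one level per connective or quantifier
  and no cuts. Open formulas under a closed substitution are treated so that the quantifier cases
  fall under the induction hypothesis.\<close>

lemma deriv_true_subst:
  fixes f :: "nat \<Rightarrow> 'e::wellorder"
  assumes f: "strict_mono f"
  shows "closed_subst \<sigma> \<Longrightarrow> X_free p \<Longrightarrow> sat {} (\<lambda>n. val (\<sigma> n)) p \<Longrightarrow>
    deriv \<theta> (f (rk p)) 0 {subst \<sigma> p}"
proof (induction p arbitrary: \<sigma>)
  case (Pos a)
  have "true_PA (subst \<sigma> (Pos a))"
    using Pos sentence_subst[OF Pos(1), of "Pos a"]
    by (simp add: true_PA_def sat_atom_subst val_def)
  then show ?case
    by (intro deriv_true_literal[of "subst \<sigma> (Pos a)"]) (auto simp: literal_def true_PA_def)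
next
  case (Neg a)
  have "true_PA (subst \<sigma> (Neg a))"
    using Neg sentence_subst[OF Neg(1), of "Neg a"]
    by (simp add: true_PA_def sat_atom_subst val_def)
  then show ?case
    by (intro deriv_true_literal[of "subst \<sigma> (Neg a)"]) (auto simp: literal_def true_PA_def)
next
  case (And p q)
  let ?n = "max (rk p) (rk q)" and ?\<Gamma> = "{subst \<sigma> (And p q)}"
  have *: "deriv \<theta> (f (rk p)) 0 {subst \<sigma> p}" "deriv \<theta> (f (rk q)) 0 {subst \<sigma> q}"
    using And by auto
  have "deriv \<theta> (f ?n) 0 (insert (subst \<sigma> p) ?\<Gamma>)" "deriv \<theta> (f ?n) 0 (insert (subst \<sigma> q) ?\<Gamma>)"
    using *[THEN deriv_weaken] f sentence_subst[OF And.prems(1)]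
    by (auto simp: strict_mono_less_eq simp del: subst.simps)
  then show ?case
    by (rule deriv_And) (use f in \<open>auto simp: strict_mono_less\<close>)
next
  case (Or p q)
  then obtain r where r: "r = p \<or> r = q" "sat {} (\<lambda>n. val (\<sigma> n)) r"
    by auto
  let ?n = "max (rk p) (rk q)" and ?\<Gamma> = "{subst \<sigma> (Or p q)}"
  have "deriv \<theta> (f (rk r)) 0 {subst \<sigma> r}"
    using Or r by auto
  then have "deriv \<theta> (f ?n) 0 (insert (subst \<sigma> r) ?\<Gamma>)"
    by (rule deriv_weaken)
      (use f sentence_subst[OF Or.prems(1)] r(1)
        in \<open>auto simp: strict_mono_less_eq simp del: subst.simps\<close>)
  then show ?case
    by (rule deriv_Or) (use f r(1) in \<open>auto simp: strict_mono_less\<close>)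
next
  case (All p)
  let ?\<Gamma> = "{subst \<sigma> (All p)}"
  show ?case
  proof (rule deriv_All)
    fix t assume t: "closed_tm t"
    have "(\<lambda>n. val (case n of 0 \<Rightarrow> t | Suc n \<Rightarrow> \<sigma> n)) = case_nat (val t) (\<lambda>n. val (\<sigma> n))"
      by (auto split: nat.split)
    then have "deriv \<theta> (f (rk p)) 0 {subst (case_nat t \<sigma>) p}"
      using All t by (intro All.IH closed_subst_case_nat) auto
    then have "deriv \<theta> (f (rk p)) 0 (insert (inst t (subst (up \<sigma>) p)) ?\<Gamma>)"
      unfolding inst_subst_up
      by (rule deriv_weaken)
        (use sentence_subst[OF All.prems(1)] sentence_subst[OF closed_subst_case_nat[OF t All.prems(1)]]
          in \<open>auto simp del: subst.simps\<close>)
    then show "\<exists>\<beta><f (rk (fm.All p)). deriv \<theta> \<beta> 0 (insert (inst t (subst (up \<sigma>) p)) ?\<Gamma>)"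
      using f by (intro exI[of _ "f (rk p)"]) (simp add: strict_mono_less)
  qed simp
next
  case (Ex p)
  let ?\<Gamma> = "{subst \<sigma> (Ex p)}"
  from Ex obtain m where m: "sat {} (case_nat m (\<lambda>n. val (\<sigma> n))) p"
    by auto
  \<comment> \<open>Truth supplies a number; the rule needs a closed term, hence the
    numeral.\<close>
  let ?t = "numeral_tm m"
  have "(\<lambda>n. val (case n of 0 \<Rightarrow> ?t | Suc n \<Rightarrow> \<sigma> n)) = case_nat m (\<lambda>n. val (\<sigma> n))"
    by (auto split: nat.split)
  then have "deriv \<theta> (f (rk p)) 0 {subst (case_nat ?t \<sigma>) p}"
    using Ex m by (intro Ex.IH closed_subst_case_nat) auto
  then have "deriv \<theta> (f (rk p)) 0 (insert (inst ?t (subst (up \<sigma>) p)) ?\<Gamma>)"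
    unfolding inst_subst_up
    by (rule deriv_weaken)
      (use sentence_subst[OF Ex.prems(1)]
         sentence_subst[OF closed_subst_case_nat[OF closed_numeral_tm Ex.prems(1)]]
        in \<open>auto simp del: subst.simps\<close>)
  then show ?case
    by (rule deriv_Ex) (use f in \<open>auto simp: strict_mono_less\<close>)
qed

lemma deriv_true:
  fixes f :: "nat \<Rightarrow> 'e::wellorder"
  assumes "strict_mono f" "sentence p" "X_free p" "sat {} (\<lambda>_. 0) p"
  shows "deriv \<theta> (f (rk p)) 0 {p}"
  using deriv_true_subst[of f "\<lambda>_. Zero" p \<theta>] assms
  by (simp add: closed_subst_def subst_sentence)

text \<open>Agreement of values is enough: \<open>ax_X\<close> compares terms by value, and for an
  atom without \<open>X\<close> one of the two literals is true.\<close>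

lemma deriv_taut_atom:
  assumes "closed_subst \<sigma>" "closed_subst \<tau>" "\<And>n. val (\<sigma> n) = val (\<tau> n)"
  shows "deriv \<theta> \<alpha> d {Pos (subst_atom \<sigma> a), Neg (subst_atom \<tau> a)}"
proof -
  have sentences: "sentence (Pos (subst_atom \<sigma> a))" "sentence (Neg (subst_atom \<tau> a))"
    using sentence_subst[OF assms(1), of "Pos a"] sentence_subst[OF assms(2), of "Neg a"] by auto
  show ?thesis
  proof (cases "X_free_atom a")
    case True
    have "sat_atom {} (\<lambda>_. 0) (subst_atom \<sigma> a) = sat_atom {} (\<lambda>_. 0) (subst_atom \<tau> a)"
      using assms(3) by (simp add: sat_atom_subst flip: val_def)
    with True sentences have "true_PA (Pos (subst_atom \<sigma> a)) \<or> true_PA (Neg (subst_atom \<tau> a))"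
      by (auto simp: true_PA_def)
    then show ?thesis
      using sentences by (elim disjE) (erule deriv_true_literal[rotated]; simp add: literal_def)+
  next
    case False
    then obtain t where a: "a = X t" by (cases a) auto
    have "val (subst_tm \<sigma> t) = val (subst_tm \<tau> t)"
      using assms(3) by (simp add: val_subst)
    then show ?thesis
      using sentences by (intro deriv.ax_X[of _ "subst_tm \<sigma> t" "subst_tm \<tau> t"]) (auto simp: a)
  qed
qed

text \<open>Two substitutions are allowed because the induction argument compares \<open>p\<close>
  at different terms of the same value. Each connective or quantifier costs two levels, one for the
  formula and one for its dual, hence the factor 2.\<close>

lemma deriv_taut:
  fixes f :: "nat \<Rightarrow> 'e::wellorder"
  assumes f: "strict_mono f"
  shows "closed_subst \<sigma> \<Longrightarrow> closed_subst \<tau> \<Longrightarrow> (\<And>n. val (\<sigma> n) = val (\<tau> n)) \<Longrightarrow>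
    deriv \<theta> (f (2 * rk p)) 0 {subst \<sigma> p, subst \<tau> (neg p)}"
proof (induction p arbitrary: \<sigma> \<tau>)
  case (Pos a)
  then show ?case using deriv_taut_atom[of \<sigma> \<tau>] by simp
next
  case (Neg a)
  then show ?case using deriv_taut_atom[of \<tau> \<sigma>] by (simp add: insert_commute)
next
  case (And p q)
  let ?n = "2 * max (rk p) (rk q)" and ?\<Gamma> = "{subst \<sigma> (And p q), subst \<tau> (neg (And p q))}"
  \<comment> \<open>For each conjunct, the disjunction on the dual side is resolved by choosing the
    matching disjunct.\<close>
  have step: "deriv \<theta> (f (Suc ?n)) 0 (insert (subst \<sigma> r) ?\<Gamma>)" if r: "r = p \<or> r = q" for r
  proof -
    have "deriv \<theta> (f (2 * rk r)) 0 {subst \<sigma> r, subst \<tau> (neg r)}"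
      using r And by auto
    then have "deriv \<theta> (f ?n) 0 (insert (subst \<tau> (neg r)) (insert (subst \<sigma> r) ?\<Gamma>))"
      by (rule deriv_weaken)
        (use f r sentence_subst And.prems in \<open>auto simp: strict_mono_less_eq simp del: subst.simps\<close>)
    then show ?thesis
      by (rule deriv_Or[where p = "subst \<tau> (neg p)" and q = "subst \<tau> (neg q)"])
        (use f r in \<open>auto simp: strict_mono_less\<close>)
  qed
  show ?case
    by (rule deriv_And[OF step[of p] step[of q]]) (use f in \<open>auto simp: strict_mono_less\<close>)
next
  case (Or p q)
  let ?n = "2 * max (rk p) (rk q)" and ?\<Gamma> = "{subst \<sigma> (Or p q), subst \<tau> (neg (Or p q))}"
  have step: "deriv \<theta> (f (Suc ?n)) 0 (insert (subst \<tau> (neg r)) ?\<Gamma>)" if r: "r = p \<or> r = q" for r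
  proof -
    have "deriv \<theta> (f (2 * rk r)) 0 {subst \<sigma> r, subst \<tau> (neg r)}"
      using r Or by auto
    then have "deriv \<theta> (f ?n) 0 (insert (subst \<sigma> r) (insert (subst \<tau> (neg r)) ?\<Gamma>))"
      by (rule deriv_weaken)
        (use f r sentence_subst Or.prems in \<open>auto simp: strict_mono_less_eq simp del: subst.simps\<close>)
    then show ?thesis
      by (rule deriv_Or[where p = "subst \<sigma> p" and q = "subst \<sigma> q"])
        (use f r in \<open>auto simp: strict_mono_less\<close>)
  qed
  show ?case
    by (rule deriv_And[OF step[of p] step[of q]]) (use f in \<open>auto simp: strict_mono_less\<close>)
next
  case (All p)
  let ?\<Gamma> = "{subst \<sigma> (All p), subst \<tau> (neg (All p))}"
  show ?case
  proof (rule deriv_All)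
    fix t assume t: "closed_tm t"
    have closed: "closed_subst (case_nat t \<sigma>)" "closed_subst (case_nat t \<tau>)"
      using t All.prems by (auto intro: closed_subst_case_nat)
    have "deriv \<theta> (f (2 * rk p)) 0 {subst (case_nat t \<sigma>) p, subst (case_nat t \<tau>) (neg p)}"
      by (rule All.IH[OF closed]) (use All.prems in \<open>auto split: nat.split\<close>)
    then have "deriv \<theta> (f (2 * rk p)) 0
        (insert (inst t (subst (up \<tau>) (neg p))) (insert (inst t (subst (up \<sigma>) p)) ?\<Gamma>))"
      unfolding inst_subst_up
      by (rule deriv_weaken)
        (use sentence_subst All.prems closed in \<open>auto simp del: subst.simps\<close>)
    \<comment> \<open>The witness on the dual side is the same \<open>t\<close> that instantiates
      the universal side.\<close>
    then have "deriv \<theta> (f (Suc (2 * rk p))) 0 (insert (inst t (subst (up \<sigma>) p)) ?\<Gamma>)"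
      by (rule deriv_Ex) (use f t in \<open>auto simp: strict_mono_less\<close>)
    then show "\<exists>\<beta><f (2 * rk (fm.All p)). deriv \<theta> \<beta> 0 (insert (inst t (subst (up \<sigma>) p)) ?\<Gamma>)"
      using f by (intro exI[of _ "f (Suc (2 * rk p))"]) (simp add: strict_mono_less)
  qed simp
next
  case (Ex p)
  let ?\<Gamma> = "{subst \<sigma> (Ex p), subst \<tau> (neg (Ex p))}"
  show ?case
  proof (rule deriv_All)
    fix t assume t: "closed_tm t"
    have closed: "closed_subst (case_nat t \<sigma>)" "closed_subst (case_nat t \<tau>)"
      using t Ex.prems by (auto intro: closed_subst_case_nat)
    have "deriv \<theta> (f (2 * rk p)) 0 {subst (case_nat t \<sigma>) p, subst (case_nat t \<tau>) (neg p)}"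
      by (rule Ex.IH[OF closed]) (use Ex.prems in \<open>auto split: nat.split\<close>)
    then have "deriv \<theta> (f (2 * rk p)) 0
        (insert (inst t (subst (up \<sigma>) p)) (insert (inst t (subst (up \<tau>) (neg p))) ?\<Gamma>))"
      unfolding inst_subst_up
      by (rule deriv_weaken)
        (use sentence_subst Ex.prems closed in \<open>auto simp del: subst.simps\<close>)
    then have "deriv \<theta> (f (Suc (2 * rk p))) 0 (insert (inst t (subst (up \<tau>) (neg p))) ?\<Gamma>)"
      by (rule deriv_Ex) (use f t in \<open>auto simp: strict_mono_less\<close>)
    then show "\<exists>\<beta><f (2 * rk (fm.Ex p)).
        deriv \<theta> \<beta> 0 (insert (inst t (subst (up \<tau>) (neg p))) ?\<Gamma>)"
      using f by (intro exI[of _ "f (Suc (2 * rk p))"]) (simp add: strict_mono_less)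
  qed simp
qed

section \<open>Derivations of the axioms\<close>

text \<open>The rule treats one disjunct at a time; two applications to the same disjunction, which
  stays in the context, absorb both.\<close>

lemma deriv_Or_both:
  fixes g :: "nat \<Rightarrow> 'e::wellorder"
  assumes "strict_mono g" "deriv \<theta> (g m) d (insert p (insert q \<Gamma>))" "Or p q \<in> \<Gamma>"
  shows "deriv \<theta> (g (m + 2)) d \<Gamma>"
proof -
  have "deriv \<theta> (g (m + 1)) d (insert q \<Gamma>)"
    by (rule deriv_Or[OF assms(2)]) (use assms in \<open>auto simp: strict_mono_less\<close>)
  then show ?thesis
    by (rule deriv_Or) (use assms in \<open>auto simp: strict_mono_less\<close>)
qed

text \<open>Heights below the \<omega>-rule come from \<open>f\<close>; the rule itself is applied
  at \<open>g 0\<close>, above all of them. The remaining four levels come from two disjunctions,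
  each introduced through both disjuncts.\<close>

lemma deriv_induction_fm:
  fixes f g :: "nat \<Rightarrow> 'e::wellorder"
  assumes f: "strict_mono f" and g: "strict_mono g" and fg: "\<And>n. f n < g 0"
    and \<sigma>: "closed_subst \<sigma>"
  shows "deriv \<theta> (g 4) 0 {subst \<sigma> (induction_fm p)}"
proof -
  let ?S = "case_nat (Succ (Var 0)) (\<lambda>n. Var (Suc n))"
  \<comment> \<open>In negation normal form the induction formula is a disjunction of the negated
    base case \<open>A\<close>, the negated step \<open>Ex body\<close> and the conclusion
    \<open>C\<close>.\<close>
  define A where "A = subst (case_nat Zero \<sigma>) (neg p)"
  define body where "body = subst (up \<sigma>) (And p (neg (subst ?S p)))"
  define C where "C = All (subst (up \<sigma>) p)"
  have A: "subst \<sigma> (neg (inst Zero p)) = A"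
    by (simp add: A_def subst_neg subst_inst)
  have shape: "subst \<sigma> (induction_fm p) = Or (Or A (Ex body)) C"
    by (simp add: induction_fm_def Imp_def A body_def C_def)
  \<comment> \<open>The successor is absorbed into the substitution, giving the form to which
    \<open>deriv_taut\<close> applies.\<close>
  have inst_body: "inst t body =
      And (subst (case_nat t \<sigma>) p) (subst (case_nat (Succ t) \<sigma>) (neg p))" for t
  proof -
    have "subst (case_nat t \<sigma>) (subst ?S p) = subst (case_nat (Succ t) \<sigma>) p"
      unfolding subst_subst by (rule subst_cong) (simp split: nat.split)
    then show ?thesis
      unfolding body_def inst_subst_up by (simp add: subst_neg)
  qed
  have "sentence (subst \<sigma> (induction_fm p))"
    by (rule sentence_subst[OF \<sigma>])
  then have sent: "sentence (Or (Or A (Ex body)) C)" "sentence (Or A (Ex body))"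
      "sentence A" "sentence (Ex body)" "sentence C"
    unfolding shape by (auto simp: sentence_def)
  have sent_inst: "sentence (subst (case_nat t \<sigma>) q)" if "closed_tm t" for t q
    using that \<sigma> by (intro sentence_subst closed_subst_case_nat)
  \<comment> \<open>The induction step is used \<open>n\<close> times. Each use costs one
    conjunction and one existential rule, hence \<open>2 * n\<close> levels above the initial
    tautology.\<close>
  have step: "deriv \<theta> (f (2 * rk p + 2 * n)) 0 {subst (case_nat t \<sigma>) p, A, Ex body}"
    if "closed_tm t" "val t = n" for t n
    using that
  proof (induction n arbitrary: t)
    case 0
    have "deriv \<theta> (f (2 * rk p)) 0 {subst (case_nat t \<sigma>) p, subst (case_nat Zero \<sigma>) (neg p)}"
      using 0 \<sigma> by (intro deriv_taut f closed_subst_case_nat) (auto split: nat.split)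
    then show ?case
      by (rule deriv_weaken) (use sent sent_inst 0 in \<open>auto simp: A_def\<close>)
  next
    case (Suc n)
    \<comment> \<open>The step is instantiated at the numeral of \<open>n\<close>. Since
      \<open>t\<close> need not be a successor term, only equality of values links it to
      \<open>Succ ?s\<close>.\<close>
    let ?s = "numeral_tm n" and ?h = "2 * rk p + 2 * n"
    let ?P = "\<lambda>t. subst (case_nat t \<sigma>) p" and ?N = "\<lambda>t. subst (case_nat t \<sigma>) (neg p)"
    let ?\<Gamma> = "{?P t, A, Ex body}" and ?\<Delta> = "{inst ?s body, ?P t, A, Ex body}"
    have sent_\<Gamma>: "sequent ?\<Gamma>" "sentence (?P ?s)" "sentence (?N (Succ ?s))"
      using sent Suc.prems by (simp_all add: sent_inst)
    then have sent_\<Delta>: "sequent ?\<Delta>"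
      by (simp add: inst_body sentence_def)
    have "deriv \<theta> (f ?h) 0 {?P ?s, A, Ex body}"
      by (rule Suc.IH) auto
    then have 1: "deriv \<theta> (f ?h) 0 (insert (?P ?s) ?\<Delta>)"
      by (rule deriv_weaken) (use sent_\<Delta> sent_\<Gamma> in auto)
    have "deriv \<theta> (f (2 * rk p)) 0 {?P t, ?N (Succ ?s)}"
      using Suc.prems \<sigma> by (intro deriv_taut f closed_subst_case_nat) (auto split: nat.split)
    then have 2: "deriv \<theta> (f ?h) 0 (insert (?N (Succ ?s)) ?\<Delta>)"
      by (rule deriv_weaken) (use sent_\<Delta> sent_\<Gamma> f in \<open>auto simp: strict_mono_less_eq\<close>)
    have "deriv \<theta> (f (Suc ?h)) 0 ?\<Delta>"
      by (rule deriv_And[OF 1 2]) (use f in \<open>auto simp: inst_body strict_mono_less\<close>)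
    then show ?case
      by (rule deriv_Ex) (use f in \<open>auto simp: strict_mono_less\<close>)
  qed
  \<comment> \<open>The heights \<open>f (2 * rk p + 2 * val t)\<close> depend on \<open>t\<close>,
    but all lie below \<open>g 0\<close>.\<close>
  have "deriv \<theta> (g 0) 0 {C, A, Ex body}"
  proof (rule deriv_All)
    fix t assume t: "closed_tm t"
    have "deriv \<theta> (f (2 * rk p + 2 * val t)) 0 (insert (inst t (subst (up \<sigma>) p)) {C, A, Ex body})"
      using step[OF t refl] unfolding inst_subst_up
      by (rule deriv_weaken) (use sent sent_inst t in auto)
    then show "\<exists>\<beta><g 0. deriv \<theta> \<beta> 0 (insert (inst t (subst (up \<sigma>) p)) {C, A, Ex body})"
      using fg by blast
  qed (simp add: C_def)
  \<comment> \<open>Both disjunctions are added in advance, since \<open>deriv_Or_both\<close>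
    requires its principal formula in the context.\<close>
  then have "deriv \<theta> (g 0) 0 {A, Ex body, Or A (Ex body), C, Or (Or A (Ex body)) C}"
    by (rule deriv_weaken) (use sent in auto)
  then have "deriv \<theta> (g (0 + 2)) 0 {Or A (Ex body), C, Or (Or A (Ex body)) C}"
    by (rule deriv_Or_both[OF g]) simp
  then have "deriv \<theta> (g (0 + 2 + 2)) 0 {Or (Or A (Ex body)) C}"
    by (rule deriv_Or_both[OF g]) simp
  then show ?thesis by (simp add: shape eval_nat_numeral)
qed

text \<open>Either the two terms have equal values and \<open>ax_X\<close> applies, or the negated
  equation is a true literal. Apart from induction axioms this is the only axiom with
  \<open>X\<close>, so \<open>deriv_true\<close> does not cover it.\<close>

lemma deriv_X_congruence:
  fixes g :: "nat \<Rightarrow> 'e::wellorder"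
  assumes g: "strict_mono g" and \<sigma>: "closed_subst \<sigma>"
  shows "deriv \<theta> (g 4) 0
    {subst \<sigma> (Imp (Pos (Eq (Var 1) (Var 0))) (Imp (Pos (X (Var 1))) (Pos (X (Var 0)))))}"
proof -
  let ?E = "Neg (Eq (\<sigma> 1) (\<sigma> 0))" and ?M = "Neg (X (\<sigma> 1))" and ?P = "Pos (X (\<sigma> 0))"
  have sent: "sentence ?E" "sentence ?M" "sentence ?P"
    "sentence (Or ?M ?P)" "sentence (Or ?E (Or ?M ?P))"
    using \<sigma> by (auto simp: sentence_def closed_subst_def closed_tm_def)
  have "deriv \<theta> (g 0) 0 {?M, ?P, ?E, Or ?M ?P, Or ?E (Or ?M ?P)}"
  proof (cases "val (\<sigma> 0) = val (\<sigma> 1)")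
    case True
    then show ?thesis using sent by (intro deriv.ax_X[of _ "\<sigma> 0" "\<sigma> 1"]) auto
  next
    case False
    then show ?thesis
      using sent by (intro deriv_true_literal[of ?E]) (auto simp: true_PA_def literal_def val_def)
  qed
  then have "deriv \<theta> (g (0 + 2)) 0 {?E, Or ?M ?P, Or ?E (Or ?M ?P)}"
    by (rule deriv_Or_both[OF g]) simp
  then have "deriv \<theta> (g (0 + 2 + 2)) 0 {Or ?E (Or ?M ?P)}"
    by (rule deriv_Or_both[OF g]) simp
  then show ?thesis by (simp add: Imp_def eval_nat_numeral)
qed

lemma PAX_sentence: "p \<in> PAX \<Longrightarrow> sentence p"
  by (auto simp: PAX_def equality_axioms_def robinson_axioms_def induction_axioms_def
      sentence_def Imp_def Iff_def)

text \<open>Axioms are sorted by how they are derived: by truth, by \<open>ax_X\<close> or by the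
  \<omega>-rule. Induction axioms all go to the last case, even those without
  \<open>X\<close>.\<close>

lemma PAX_cases:
  assumes "p \<in> PAX"
  obtains (true) "X_free p" "sat {} (\<lambda>_. 0) p"
  | (X_congruence) "p = (All ^^ 2)
      (Imp (Pos (Eq (Var 1) (Var 0))) (Imp (Pos (X (Var 1))) (Pos (X (Var 0)))))"
  | (induction) n q where "p = (All ^^ n) (induction_fm q)"
proof -
  \<comment> \<open>\<open>pred\<close> and \<open>le\<close> serve to verify, in the natural
    numbers, the predecessor axiom and the axiom that expresses the order by addition.\<close>
  have pred: "(\<forall>m. n \<noteq> Suc m) \<longleftrightarrow> n = 0" for n
    by (cases n) auto
  have le: "(m \<le> n) = (\<exists>k. k + m = n)" for m n :: nat
    by (metis add.commute le_iff_add)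
  from assms consider "p \<in> equality_axioms" | "p \<in> robinson_axioms" | "p \<in> induction_axioms"
    by (auto simp: PAX_def)
  then show ?thesis
  proof cases
    case 1
    then show ?thesis
      using true X_congruence
      by (auto simp: equality_axioms_def Imp_def numeral_2_eq_2 numeral_3_eq_3)
  next
    case 2
    then have "X_free p \<and> sat {} (\<lambda>_. 0) p"
      by (auto simp: robinson_axioms_def Imp_def Iff_def numeral_2_eq_2 pred le)
    then show ?thesis using true by blast
  next
    case 3
    then show ?thesis using induction by (auto simp: induction_axioms_def)
  qed
qed

text \<open>All heights are taken from the one chain \<open>g\<close>, so that they can be compared
  when the axioms are cut away.\<close>

lemma deriv_PAX:
  fixes f g :: "nat \<Rightarrow> 'e::wellorder"
  assumes f: "strict_mono f" and g: "strict_mono g" and fg: "\<And>n. f n < g 0"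
    and p: "p \<in> PAX"
  shows "\<exists>k. deriv \<theta> (g k) 0 {p}"
proof -
  have sent: "sentence p" using p by (rule PAX_sentence)
  \<comment> \<open>Any closed substitution would do, as the axioms are sentences and remain
    unchanged.\<close>
  have Zero: "closed_subst (\<lambda>_. Zero)" by (simp add: closed_subst_def)
  from p show ?thesis
  proof (cases rule: PAX_cases)
    case true
    then show ?thesis using deriv_true[OF g sent] by blast
  next
    case X_congruence
    then show ?thesis
      using deriv_All_closure[OF g Zero deriv_X_congruence[OF g], of _ 2] subst_sentence[OF sent]
      by metis
  next
    case (induction n q)
    then show ?thesis
      using deriv_All_closure[OF g Zero deriv_induction_fm[OF f g fg], of _ n] subst_sentence[OF sent]
      by metis
  qed
qed

section \<open>Embedding\<close>

text \<open>The bounds \<open>k\<close> and \<open>d\<close> are chosen before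
  \<open>\<sigma>\<close>: in the case of \<open>All\<close> the premise is used at
  \<open>case_nat t \<sigma>\<close> for every closed \<open>t\<close>, with the same height and cut
  rank. Each logical rule or cut adds one level to the larger premise bound.\<close>

lemma deriv_LK:
  fixes g :: "nat \<Rightarrow> 'e::wellorder"
  assumes g: "strict_mono g"
  shows "LK \<Gamma> \<Longrightarrow> \<exists>k d. \<forall>\<sigma>. closed_subst \<sigma> \<longrightarrow> deriv \<theta> (g k) d (subst \<sigma> ` \<Gamma>)"
proof (induction rule: LK.induct)
  case (Ax \<Gamma> a)
  have "deriv \<theta> (g 0) 0 (subst \<sigma> ` \<Gamma>)" if \<sigma>: "closed_subst \<sigma>" for \<sigma>
  proof (rule deriv_weaken[OF deriv_taut_atom[OF \<sigma> \<sigma> refl, of _ _ _ a]])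
    show "{Pos (subst_atom \<sigma> a), Neg (subst_atom \<sigma> a)} \<subseteq> subst \<sigma> ` \<Gamma>"
      using Ax imageI[of "Pos a" \<Gamma> "subst \<sigma>"] imageI[of "Neg a" \<Gamma> "subst \<sigma>"] by simp
    show "sequent (subst \<sigma> ` \<Gamma>)"
      using Ax sentence_subst[OF \<sigma>] by (auto simp: sequent_def)
  qed auto
  then show ?case by blast
next
  case (And p \<Gamma> q)
  then obtain k1 d1 k2 d2 where
    1: "\<And>\<sigma>. closed_subst \<sigma> \<Longrightarrow> deriv \<theta> (g k1) d1 (subst \<sigma> ` insert p \<Gamma>)" and
    2: "\<And>\<sigma>. closed_subst \<sigma> \<Longrightarrow> deriv \<theta> (g k2) d2 (subst \<sigma> ` insert q \<Gamma>)"
    by blast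
  let ?k = "max k1 k2" and ?d = "max d1 d2"
  have "deriv \<theta> (g (Suc ?k)) ?d (subst \<sigma> ` insert (And p q) \<Gamma>)" if \<sigma>: "closed_subst \<sigma>" for \<sigma>
  proof (rule deriv_And)
    note sent = deriv_sequent[OF 1[OF \<sigma>]] sentence_subst[OF \<sigma>]
    \<comment> \<open>The working form keeps the principal formula in its premises, so it is added
      by weakening.\<close>
    show "deriv \<theta> (g ?k) ?d (insert (subst \<sigma> p) (subst \<sigma> ` insert (And p q) \<Gamma>))"
      by (rule deriv_weaken[OF 1[OF \<sigma>]])
        (use g sent in \<open>auto simp: strict_mono_less_eq simp del: subst.simps\<close>)
    show "deriv \<theta> (g ?k) ?d (insert (subst \<sigma> q) (subst \<sigma> ` insert (And p q) \<Gamma>))"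
      by (rule deriv_weaken[OF 2[OF \<sigma>]])
        (use g sent in \<open>auto simp: strict_mono_less_eq simp del: subst.simps\<close>)
  qed (use g in \<open>auto simp: strict_mono_less\<close>)
  then show ?case by blast
next
  case (Or1 p \<Gamma> q)
  then obtain k d where
    1: "\<And>\<sigma>. closed_subst \<sigma> \<Longrightarrow> deriv \<theta> (g k) d (subst \<sigma> ` insert p \<Gamma>)"
    by blast
  have "deriv \<theta> (g (Suc k)) d (subst \<sigma> ` insert (Or p q) \<Gamma>)" if \<sigma>: "closed_subst \<sigma>" for \<sigma>
  proof (rule deriv_Or)
    show "deriv \<theta> (g k) d (insert (subst \<sigma> p) (subst \<sigma> ` insert (Or p q) \<Gamma>))"
      by (rule deriv_weaken[OF 1[OF \<sigma>]])
        (use deriv_sequent[OF 1[OF \<sigma>]] sentence_subst[OF \<sigma>] in \<open>auto simp del: subst.simps\<close>)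
  qed (use g in \<open>auto simp: strict_mono_less\<close>)
  then show ?case by blast
next
  case (Or2 q \<Gamma> p)
  then obtain k d where
    1: "\<And>\<sigma>. closed_subst \<sigma> \<Longrightarrow> deriv \<theta> (g k) d (subst \<sigma> ` insert q \<Gamma>)"
    by blast
  have "deriv \<theta> (g (Suc k)) d (subst \<sigma> ` insert (Or p q) \<Gamma>)" if \<sigma>: "closed_subst \<sigma>" for \<sigma>
  proof (rule deriv_Or)
    show "deriv \<theta> (g k) d (insert (subst \<sigma> q) (subst \<sigma> ` insert (Or p q) \<Gamma>))"
      by (rule deriv_weaken[OF 1[OF \<sigma>]])
        (use deriv_sequent[OF 1[OF \<sigma>]] sentence_subst[OF \<sigma>] in \<open>auto simp del: subst.simps\<close>)
  qed (use g in \<open>auto simp: strict_mono_less\<close>)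
  then show ?case by blast
next
  case (All p \<Gamma>)
  then obtain k d where
    1: "\<And>\<sigma>. closed_subst \<sigma> \<Longrightarrow> deriv \<theta> (g k) d (subst \<sigma> ` insert p (shift ` \<Gamma>))"
    by blast
  have "deriv \<theta> (g (Suc k)) d (subst \<sigma> ` insert (All p) \<Gamma>)" if \<sigma>: "closed_subst \<sigma>" for \<sigma>
  proof (rule deriv_All)
    fix t assume t: "closed_tm t"
    \<comment> \<open>The eigenvariable is assigned \<open>t\<close>, which leaves the shifted
      context untouched.\<close>
    have "deriv \<theta> (g k) d (subst (case_nat t \<sigma>) ` insert p (shift ` \<Gamma>))"
      by (intro 1 closed_subst_case_nat t \<sigma>)
    then have 2: "deriv \<theta> (g k) d (insert (inst t (subst (up \<sigma>) p)) (subst \<sigma> ` \<Gamma>))"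
      by (simp add: inst_subst_up subst_case_nat_shift image_image)
    have "deriv \<theta> (g k) d (insert (inst t (subst (up \<sigma>) p)) (subst \<sigma> ` insert (All p) \<Gamma>))"
      by (rule deriv_weaken[OF 2])
        (use deriv_sequent[OF 2] sentence_subst[OF \<sigma>] in \<open>auto simp del: subst.simps\<close>)
    then show "\<exists>\<beta><g (Suc k).
        deriv \<theta> \<beta> d (insert (inst t (subst (up \<sigma>) p)) (subst \<sigma> ` insert (All p) \<Gamma>))"
      using g by (intro exI[of _ "g k"]) (simp add: strict_mono_less)
  qed simp
  then show ?case by blast
next
  case (Ex t p \<Gamma>)
  then obtain k d where
    1: "\<And>\<sigma>. closed_subst \<sigma> \<Longrightarrow> deriv \<theta> (g k) d (subst \<sigma> ` insert (inst t p) \<Gamma>)"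
    by blast
  have "deriv \<theta> (g (Suc k)) d (subst \<sigma> ` insert (Ex p) \<Gamma>)" if \<sigma>: "closed_subst \<sigma>" for \<sigma>
  proof (rule deriv_Ex)
    \<comment> \<open>The witness \<open>t\<close> may be open; \<open>\<sigma>\<close> turns it
      into a closed term.\<close>
    have 2: "deriv \<theta> (g k) d
        (insert (inst (subst_tm \<sigma> t) (subst (up \<sigma>) p)) (subst \<sigma> ` \<Gamma>))"
      using 1[OF \<sigma>] by (simp add: subst_inst inst_subst_up)
    show "deriv \<theta> (g k) d
        (insert (inst (subst_tm \<sigma> t) (subst (up \<sigma>) p)) (subst \<sigma> ` insert (Ex p) \<Gamma>))"
      by (rule deriv_weaken[OF 2])
        (use deriv_sequent[OF 2] sentence_subst[OF \<sigma>] in \<open>auto simp del: subst.simps\<close>)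
  qed (use g \<sigma> in \<open>auto simp: strict_mono_less closed_tm_subst\<close>)
  then show ?case by blast
next
  case (Cut p \<Gamma>)
  then obtain k1 d1 k2 d2 where
    1: "\<And>\<sigma>. closed_subst \<sigma> \<Longrightarrow> deriv \<theta> (g k1) d1 (subst \<sigma> ` insert p \<Gamma>)" and
    2: "\<And>\<sigma>. closed_subst \<sigma> \<Longrightarrow> deriv \<theta> (g k2) d2 (subst \<sigma> ` insert (neg p) \<Gamma>)"
    by blast
  \<comment> \<open>The cut rank must strictly exceed the rank of the cut formula; substitution
    preserves that rank, so \<open>?d\<close> is independent of \<open>\<sigma>\<close>.\<close>
  let ?k = "max k1 k2" and ?d = "max (Suc (rk p)) (max d1 d2)"
  have "deriv \<theta> (g (Suc ?k)) ?d (subst \<sigma> ` \<Gamma>)" if \<sigma>: "closed_subst \<sigma>" for \<sigma>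
  proof (rule deriv_Cut)
    note sent = deriv_sequent[OF 1[OF \<sigma>]] sentence_subst[OF \<sigma>]
    show "deriv \<theta> (g ?k) ?d (insert (subst \<sigma> p) (subst \<sigma> ` \<Gamma>))"
      by (rule deriv_weaken[OF 1[OF \<sigma>]]) (use g sent in \<open>auto simp: strict_mono_less_eq\<close>)
    show "deriv \<theta> (g ?k) ?d (insert (neg (subst \<sigma> p)) (subst \<sigma> ` \<Gamma>))"
      by (rule deriv_weaken[OF 2[OF \<sigma>]])
        (use g sent in \<open>auto simp: strict_mono_less_eq subst_neg\<close>)
  qed (use g in \<open>auto simp: strict_mono_less\<close>)
  then show ?case by blast
qed

text \<open>Each axiom is removed by one cut against its own derivation. This changes height and cut
  rank, so both are generalized in the induction on \<open>\<Delta>\<close>.\<close>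

lemma deriv_cut_axioms:
  fixes g :: "nat \<Rightarrow> 'e::wellorder"
  assumes g: "strict_mono g" and "finite \<Delta>"
    and "\<And>p. p \<in> \<Delta> \<Longrightarrow> \<exists>k. deriv \<theta> (g k) 0 {p}"
    and "deriv \<theta> (g k) d (\<Gamma> \<union> neg ` \<Delta>)"
  shows "\<exists>k d. deriv \<theta> (g k) d \<Gamma>"
  using assms(2-4)
proof (induction \<Delta> arbitrary: k d rule: finite_induct)
  case empty
  then show ?case by auto
next
  case (insert p \<Delta>)
  from insert.prems(1) obtain m where m: "deriv \<theta> (g m) 0 {p}"
    by auto
  let ?k = "max k m" and ?d = "max (Suc (rk p)) d"
  have sent: "sequent (\<Gamma> \<union> neg ` \<Delta>)" "sentence p"
    using deriv_sequent[OF insert.prems(2)] by simp_all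
  have "deriv \<theta> (g ?k) ?d (insert p (\<Gamma> \<union> neg ` \<Delta>))"
    by (rule deriv_weaken[OF m]) (use g sent in \<open>auto simp: strict_mono_less_eq\<close>)
  moreover have "deriv \<theta> (g ?k) ?d (insert (neg p) (\<Gamma> \<union> neg ` \<Delta>))"
    by (rule deriv_weaken[OF insert.prems(2)])
      (use g sent in \<open>auto simp: strict_mono_less_eq\<close>)
  ultimately have "deriv \<theta> (g (Suc ?k)) ?d (\<Gamma> \<union> neg ` \<Delta>)"
    by (rule deriv_Cut) (use g in \<open>auto simp: strict_mono_less\<close>)
  then show ?case
    using insert.IH insert.prems(1) by blast
qed

theorem theorem3p7:
  fixes succ :: "'e::wellorder \<Rightarrow> 'e" and zero omega :: 'e
    and \<theta> \<phi> :: fm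
  assumes "\<And>\<alpha>. \<alpha> < succ \<alpha>"
    and "zero < omega"
    and "\<And>\<alpha>. \<alpha> < omega \<Longrightarrow> succ \<alpha> < omega"
    and "defines_strict_well_order \<theta>"
    and "sentence \<phi>"
    and "provable PAX \<phi>"
  shows "\<exists>(\<alpha>::'e) (d::nat). deriv \<theta> \<alpha> d {\<phi>}"
proof -
  \<comment> \<open>The chain \<open>f\<close> supplies finite heights, which stay below
    \<open>omega\<close> by closure under \<open>succ\<close>; \<open>g\<close> continues from
    \<open>omega\<close> upwards.\<close>
  define f where "f n = (succ ^^ n) zero" for n
  define g where "g n = (succ ^^ n) omega" for n
  have f: "strict_mono f" and g: "strict_mono g"
    using assms(1) by (auto simp: strict_mono_Suc_iff f_def g_def)
  have fg: "f n < g 0" for n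
    by (induction n) (auto simp: f_def g_def assms(2,3))
  from assms(6) obtain \<Delta> where \<Delta>: "finite \<Delta>" "\<Delta> \<subseteq> PAX" "LK (insert \<phi> (neg ` \<Delta>))"
    by (auto simp: provable_def)
  from deriv_LK[OF g \<Delta>(3), of \<theta>] obtain k d where
    "\<forall>\<sigma>. closed_subst \<sigma> \<longrightarrow> deriv \<theta> (g k) d (subst \<sigma> ` insert \<phi> (neg ` \<Delta>))"
    by blast
  then have "deriv \<theta> (g k) d (subst (\<lambda>_. Zero) ` insert \<phi> (neg ` \<Delta>))"
    by (simp add: closed_subst_def)
  \<comment> \<open>The sequent consists of sentences, so closing it changes nothing. The identity
    image on the right lets \<open>image_cong\<close> compare both sides pointwise.\<close>
  moreover have "subst (\<lambda>_. Zero) ` insert \<phi> (neg ` \<Delta>) = (\<lambda>p. p) ` insert \<phi> (neg ` \<Delta>)"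
    by (rule image_cong[OF refl], rule subst_sentence)
      (use assms(5) \<Delta>(2) PAX_sentence in auto)
  ultimately have "deriv \<theta> (g k) d ({\<phi>} \<union> neg ` \<Delta>)"
    by simp
  from deriv_cut_axioms[OF g \<Delta>(1) _ this] show ?thesis
    using deriv_PAX[OF f g fg] \<Delta>(2) by blast
qed

end
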